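(* Let $n\ge 1$ and let $M_{\mathrm{lvl}}$ be the Markov arrival process (MAP) resulting from the level superposition of $n$ independent symmetric sub-trees, each modelled by the same MAP $(\mathbf d_0,\mathbf d_1)$ with finite state set $\mathcal S$. Let $\rho=\{\rho_1,\dots,\rho_{N_p}\}$ be the partition of the state set $\mathcal S^n$ of $M_{\mathrm{lvl}}$ into equivalence classes, where $A,B\in\mathcal S^n$ are equivalent if and only if $B=f.A$ for some permutation $f$ of the $n$ sub-trees. Then $M_{\mathrm{lvl}}$ is lumpable with respect to $\rho$.
   Context: A MAP is given by two square matrices $(\mathbf D_0,\mathbf D_1)$ of the same size, containing hidden and active transition rates respectively, such that $\mathbf D_0+\mathbf D_1$ is the generator of a finite-state continuous-time Markov chain. The level superposition of MAPs $(\mathbf D_0^{(j)},\mathbf D_1^{(j)})$, $j=1,\dots,n$, is the MAP $(\mathbf D_0,\mathbf D_1)$ with $\mathbf D_b=\mathbf D_b^{(1)}\oplus\cdots\oplus\mathbf D_b^{(n)}$ (Kronecker sum), $b=0,1$; its states are tuples $A=(A_1,\dots,A_n)$ with $A_j$ a state of the $j$-th MAP. Symmetric sub-trees have identical MAPs, so here $(\mathbf D_0^{(j)},\mathbf D_1^{(j)})=(\mathbf d_0,\mathbf d_1)$ for all $j$ and the state set is $\mathcal S^n$. Put $\mathbf Q=\mathbf D_0+\mathbf D_1$, with entries $Q_{A,B}$, the total transition matrix of the superposed MAP. A permutation $f$ of $\{1,\dots,n\}$ acts on $\mathcal S^n$ by: $f.A=B$ iff $A_i=B_{f(i)}$ for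 all $i$. The MAP is lumpable with respect to $\rho$ iff for every pair of classes $\rho_i,\rho_j$ the sum $\sum_{B\in\rho_j}Q_{A,B}$ takes the same value for all $A\in\rho_i$. *)

theory Defs
  imports Complex_Main "HOL-Combinatorics.Permutations" "HOL-Library.Disjoint_Sets"
begin

text \<open>Square matrices are indexed directly by states: only the entries at states in the carrier
  matter. This makes iterated Kronecker sums, whose size depends on a number, expressible.\<close>

type_synonym 'i mat = "'i \<Rightarrow> 'i \<Rightarrow> real"

definition id_mat :: "'i mat" where
  "id_mat i j = (if i = j then 1 else 0)"

definition mat_add :: "'i mat \<Rightarrow> 'i mat \<Rightarrow> 'i mat" where
  "mat_add M N i j = M i j + N i j"

text \<open>Rows and columns of a Kronecker product are indexed by pairs of indices, instead of by the
  lexicographic number of such a pair.\<close>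

definition kron_prod :: "'i mat \<Rightarrow> 'k mat \<Rightarrow> ('i \<times> 'k) mat" where
  "kron_prod M N = (\<lambda>(i, k) (j, l). M i j * N k l)"

definition kron_sum :: "'i mat \<Rightarrow> 'k mat \<Rightarrow> ('i \<times> 'k) mat" where
  "kron_sum M N = mat_add (kron_prod M id_mat) (kron_prod id_mat N)"

text \<open>In the iterated Kronecker sum a nonempty tuple \<open>xs\<close> is identified with the pair
  \<open>(hd xs, tl xs)\<close>. The empty sum is the \<open>1 \<times> 1\<close> zero matrix, which is neutral for
  \<^const>\<open>kron_sum\<close>.\<close>

primrec kron_sum_list :: "'i mat list \<Rightarrow> 'i list mat" where
  "kron_sum_list [] = (\<lambda>xs ys. 0)"
| "kron_sum_list (M # Ms) =
     (\<lambda>xs ys. kron_sum M (kron_sum_list Ms) (hd xs, tl xs) (hd ys, tl ys))"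

record 's arrival_process =
  states :: "'s set"
  hidden :: "'s mat"
  active :: "'s mat"

definition total_matrix :: "'s arrival_process \<Rightarrow> 's mat" where
  "total_matrix M = mat_add (hidden M) (active M)"

definition ctmc_generator :: "'s set \<Rightarrow> 's mat \<Rightarrow> bool" where
  "ctmc_generator S Q \<longleftrightarrow>
     finite S \<and>
     (\<forall>i\<in>S. \<forall>j\<in>S. i \<noteq> j \<longrightarrow> 0 \<le> Q i j) \<and>
     (\<forall>i\<in>S. (\<Sum>j\<in>S. Q i j) = 0)"

text \<open>The diagonal of the hidden matrix carries no transition rates: it is determined by the
  requirement that the total matrix has row sums zero.\<close>

definition is_MAP :: "'s arrival_process \<Rightarrow> bool" where
  "is_MAP M \<longleftrightarrow>
     (\<forall>i\<in>states M. \<forall>j\<in>states M. i \<noteq> j \<longrightarrow> 0 \<le> hidden M i j) \<and>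
     (\<forall>i\<in>states M. \<forall>j\<in>states M. 0 \<le> active M i j) \<and>
     ctmc_generator (states M) (total_matrix M)"

definition level_superposition :: "'s arrival_process list \<Rightarrow> 's list arrival_process" where
  "level_superposition Ms =
     \<lparr>states = listset (map states Ms),
      hidden = kron_sum_list (map hidden Ms),
      active = kron_sum_list (map active Ms)\<rparr>"

text \<open>\<open>perm_acts n f A B\<close> says \<open>f.A = B\<close>. Components are numbered from 0. The library's
  \<^const>\<open>permute_list\<close> is the inverse action: \<open>A = permute_list f B\<close>.\<close>

definition perm_acts :: "nat \<Rightarrow> (nat \<Rightarrow> nat) \<Rightarrow> 's list \<Rightarrow> 's list \<Rightarrow> bool" where
  "perm_acts n f A B \<longleftrightarrow> (\<forall>i<n. A ! i = B ! f i)"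

definition perm_equiv :: "nat \<Rightarrow> 's list set \<Rightarrow> ('s list \<times> 's list) set" where
  "perm_equiv n X =
     {(A, B). A \<in> X \<and> B \<in> X \<and> (\<exists>f. f permutes {..<n} \<and> perm_acts n f A B)}"

definition perm_classes :: "nat \<Rightarrow> 's list set \<Rightarrow> 's list set set" where
  "perm_classes n X = X // perm_equiv n X"

definition lumpable :: "'s arrival_process \<Rightarrow> 's set set \<Rightarrow> bool" where
  "lumpable M \<rho> \<longleftrightarrow>
     (\<forall>R\<in>\<rho>. \<forall>R'\<in>\<rho>. \<forall>A\<in>R. \<forall>A'\<in>R.
        (\<Sum>B\<in>R'. total_matrix M A B) = (\<Sum>B\<in>R'. total_matrix M A' B))"

lemma equiv_perm_equiv: "equiv X (perm_equiv n X)"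
proof (rule equivI)
  show "perm_equiv n X \<subseteq> X \<times> X" "refl_on X (perm_equiv n X)"
    unfolding perm_equiv_def refl_on_def perm_acts_def
    by (auto intro!: exI[of _ id] permutes_id)
  show "sym (perm_equiv n X)"
  proof (rule symI)
    fix A B assume "(A, B) \<in> perm_equiv n X"
    then obtain f where AB: "A \<in> X" "B \<in> X" and f: "f permutes {..<n}" "\<forall>i<n. A ! i = B ! f i"
      by (auto simp: perm_equiv_def perm_acts_def)
    have "B ! i = A ! inv f i" if "i < n" for i
      using f that permutes_in_image[OF permutes_inv[OF f(1)], of i] permutes_inverses(1)[OF f(1)]
      by auto
    with AB permutes_inv[OF f(1)] show "(B, A) \<in> perm_equiv n X"
      by (auto simp: perm_equiv_def perm_acts_def)
  qed
  show "trans (perm_equiv n X)"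
  proof (rule transI)
    fix A B C assume "(A, B) \<in> perm_equiv n X" "(B, C) \<in> perm_equiv n X"
    then obtain f g where X: "A \<in> X" "C \<in> X"
      and f: "f permutes {..<n}" "\<forall>i<n. A ! i = B ! f i"
      and g: "g permutes {..<n}" "\<forall>i<n. B ! i = C ! g i"
      by (auto simp: perm_equiv_def perm_acts_def)
    have "A ! i = C ! (g \<circ> f) i" if "i < n" for i
      using f g that permutes_in_image[OF f(1), of i] by auto
    with X permutes_compose[OF f(1) g(1)] show "(A, C) \<in> perm_equiv n X"
      by (auto simp: perm_equiv_def perm_acts_def)
  qed
qed

lemma partition_on_perm_classes: "partition_on X (perm_classes n X)"
  unfolding perm_classes_def by (rule partition_on_quotient) (rule equiv_perm_equiv)

lemmas kron_defs = kron_sum_def kron_prod_def mat_add_def id_mat_def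

lemma kron_sum_list_add:
  "kron_sum_list (map (\<lambda>M. mat_add (g M) (h M)) Ms) =
     mat_add (kron_sum_list (map g Ms)) (kron_sum_list (map h Ms))"
  by (induction Ms) (auto simp: fun_eq_iff kron_defs algebra_simps)

lemma total_matrix_level_superposition:
  "total_matrix (level_superposition Ms) = kron_sum_list (map total_matrix Ms)"
  using kron_sum_list_add[of hidden active Ms]
  by (simp add: total_matrix_def[abs_def] level_superposition_def)

lemma kron_sum_list_offdiag_nonneg:
  assumes "\<And>M. M \<in> set Ms \<Longrightarrow> \<forall>i\<in>states M. \<forall>j\<in>states M. i \<noteq> j \<longrightarrow> 0 \<le> g M i j"
    and "A \<in> listset (map states Ms)" "B \<in> listset (map states Ms)" "A \<noteq> B"
  shows "0 \<le> kron_sum_list (map g Ms) A B"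
  using assms
proof (induction Ms arbitrary: A B)
  case (Cons M Ms)
  then obtain a A' b B' where AB: "A = a # A'" "B = b # B'" "a \<in> states M" "b \<in> states M"
      "A' \<in> listset (map states Ms)" "B' \<in> listset (map states Ms)"
    by (auto simp: set_Cons_def)
  have "0 \<le> kron_sum_list (map g Ms) A' B'" if "A' \<noteq> B'"
    using Cons.IH[of A' B'] Cons.prems(1) AB that by auto
  moreover have "0 \<le> g M a b" if "a \<noteq> b"
    using Cons.prems(1)[of M] AB that by auto
  ultimately show ?case
    using AB Cons.prems(4) by (auto simp: kron_defs)
qed simp

lemma kron_sum_list_nonneg:
  assumes "\<And>M. M \<in> set Ms \<Longrightarrow> \<forall>i\<in>states M. \<forall>j\<in>states M. 0 \<le> g M i j"
    and "A \<in> listset (map states Ms)" "B \<in> listset (map states Ms)"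
  shows "0 \<le> kron_sum_list (map g Ms) A B"
  using assms
proof (induction Ms arbitrary: A B)
  case (Cons M Ms)
  then obtain a A' b B' where AB: "A = a # A'" "B = b # B'" "a \<in> states M" "b \<in> states M"
      "A' \<in> listset (map states Ms)" "B' \<in> listset (map states Ms)"
    by (auto simp: set_Cons_def)
  have "0 \<le> kron_sum_list (map g Ms) A' B'"
    using Cons.IH[of A' B'] Cons.prems(1) AB by auto
  moreover have "0 \<le> g M a b"
    using Cons.prems(1)[of M] AB by auto
  ultimately show ?case
    using AB by (auto simp: kron_defs)
qed simp

lemma finite_listset:
  "(\<And>X. X \<in> set Xs \<Longrightarrow> finite X) \<Longrightarrow> finite (listset Xs)"
proof (induction Xs)
  case (Cons X Xs)
  have "listset (X # Xs) = (\<lambda>(x, xs). x # xs) ` (X \<times> listset Xs)"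
    by (auto simp: set_Cons_def)
  with Cons show ?case by simp
qed simp

lemma kron_sum_list_row_sum:
  assumes "\<And>M. M \<in> set Ms \<Longrightarrow> finite (states M) \<and> (\<forall>i\<in>states M. (\<Sum>j\<in>states M. g M i j) = 0)"
    and "A \<in> listset (map states Ms)"
  shows "(\<Sum>B\<in>listset (map states Ms). kron_sum_list (map g Ms) A B) = 0"
  using assms
proof (induction Ms arbitrary: A)
  case (Cons M Ms)
  let ?L = "listset (map states Ms)" and ?K = "kron_sum_list (map g Ms)"
  obtain a A' where A: "A = a # A'" "a \<in> states M" "A' \<in> ?L"
    using Cons.prems(2) by (auto simp: set_Cons_def)
  have fin: "finite (states M)" "finite ?L"
    using Cons.prems(1) by (auto intro!: finite_listset)
  have L: "listset (map states (M # Ms)) = (\<lambda>(x, xs). x # xs) ` (states M \<times> ?L)"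
    by (auto simp: set_Cons_def)
  have "(\<Sum>B\<in>listset (map states (M # Ms)). kron_sum_list (map g (M # Ms)) A B) =
      (\<Sum>(b, B)\<in>states M \<times> ?L. g M a b * id_mat A' B + id_mat a b * ?K A' B)"
    unfolding L by (subst sum.reindex)
      (auto simp: inj_on_def A kron_sum_def kron_prod_def mat_add_def intro!: sum.cong)
  also have "\<dots> = (\<Sum>b\<in>states M. g M a b) * (\<Sum>B\<in>?L. id_mat A' B) +
      (\<Sum>b\<in>states M. id_mat a b) * (\<Sum>B\<in>?L. ?K A' B)"
    by (simp add: sum.cartesian_product[symmetric] sum.distrib sum_product)
  also have "\<dots> = 0"
    using Cons.prems(1)[of M] Cons.IH[of A'] Cons.prems(1) A by simp
  finally show ?case .
qed simp

lemma is_MAP_level_superposition: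
  assumes "\<And>M. M \<in> set Ms \<Longrightarrow> is_MAP M"
  shows "is_MAP (level_superposition Ms)"
proof -
  have M: "\<forall>i\<in>states M. \<forall>j\<in>states M. i \<noteq> j \<longrightarrow> 0 \<le> hidden M i j"
    "\<forall>i\<in>states M. \<forall>j\<in>states M. 0 \<le> active M i j"
    "\<forall>i\<in>states M. \<forall>j\<in>states M. i \<noteq> j \<longrightarrow> 0 \<le> total_matrix M i j"
    "finite (states M) \<and> (\<forall>i\<in>states M. (\<Sum>j\<in>states M. total_matrix M i j) = 0)"
    if "M \<in> set Ms" for M
    using assms[OF that] unfolding is_MAP_def ctmc_generator_def by blast+
  have "finite (listset (map states Ms))"
    using M(4) by (auto intro!: finite_listset)
  then show ?thesis
    unfolding is_MAP_def ctmc_generator_def total_matrix_level_superposition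
    using kron_sum_list_offdiag_nonneg[of Ms hidden, OF M(1)]
      kron_sum_list_nonneg[of Ms active, OF M(2)]
      kron_sum_list_offdiag_nonneg[of Ms total_matrix, OF M(3)]
      kron_sum_list_row_sum[of Ms total_matrix, OF M(4)]
    by (simp add: level_superposition_def)
qed

end

(* Expanded, the Kronecker sum is the sum over positions i of the products with a rate at position i
   and Kronecker deltas elsewhere. Permuting both states in the same way therefore only reorders
   the terms, so Q is invariant under the diagonal action of a permutation. If f relates
   two states of one class, then B \<mapsto> permute_list f B is a bijection of any target class onto
   itself which matches the terms of the two row sums. *)
theory Submission
  imports Defs
begin

text \<open>Lists of equal length that differ do so at some position, and the zero factor there
  makes the product vanish.\<close>

lemma id_mat_eq_prod:
  "length A = length B \<Longrightarrow> id_mat A B = (\<Prod>j<length A. id_mat (A ! j) (B ! j))"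
  by (auto simp: id_mat_def list_eq_iff_nth_eq)

text \<open>Induction on \<open>Ms\<close>: the term \<open>i = 0\<close> is the head rate times the
  delta of the tails, split by \<open>id_mat_eq_prod\<close>; the terms with \<open>i > 0\<close>
  carry a delta at the head and come from the tail.\<close>

lemma kron_sum_list_eq_sum_prod:
  assumes "length A = length Ms" "length B = length Ms"
  shows "kron_sum_list Ms A B =
    (\<Sum>i<length Ms. \<Prod>j<length Ms. (if j = i then Ms ! j else id_mat) (A ! j) (B ! j))"
  using assms
proof (induction Ms arbitrary: A B)
  case (Cons M Ms)
  then obtain a A' b B' where AB: "A = a # A'" "B = b # B'"
      "length A' = length Ms" "length B' = length Ms"
    by (auto simp: length_Suc_conv)
  show ?case
    using Cons.IH[of A' B'] id_mat_eq_prod[of A' B'] AB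
    by (simp add: kron_sum_def kron_prod_def mat_add_def sum.lessThan_Suc_shift
        prod.lessThan_Suc_shift sum_distrib_left
        cong: if_cong del: sum.lessThan_Suc prod.lessThan_Suc)
qed simp

text \<open>The matrices move along with the states, so they may differ; for a constant list this
  becomes invariance of a single matrix.\<close>

lemma kron_sum_list_permute_list:
  assumes f: "f permutes {..<length Ms}"
    and len: "length A = length Ms" "length B = length Ms"
  shows "kron_sum_list (permute_list f Ms) (permute_list f A) (permute_list f B) =
    kron_sum_list Ms A B"
proof -
  let ?n = "length Ms"
  let ?g = "\<lambda>i j. (if j = i then Ms ! j else id_mat) (A ! j) (B ! j)"
  \<comment> \<open>Injectivity of \<open>f\<close> turns the test \<open>j = i\<close> into
    \<open>f j = f i\<close>. Then \<open>f\<close> is removed first from the product index and then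
    from the sum index.\<close>
  have "kron_sum_list (permute_list f Ms) (permute_list f A) (permute_list f B) =
      (\<Sum>i<?n. \<Prod>j<?n. ?g (f i) (f j))"
    using f len
    by (auto simp: kron_sum_list_eq_sum_prod permute_list_nth inj_eq[OF permutes_inj[OF f]]
        intro!: sum.cong prod.cong)
  also have "\<dots> = (\<Sum>i<?n. \<Prod>j<?n. ?g (f i) j)"
    using prod.permute[OF f, of "?g (f i)" for i] by (simp add: o_def)
  also have "\<dots> = (\<Sum>i<?n. \<Prod>j<?n. ?g i j)"
    using sum.permute[OF f, of "\<lambda>i. \<Prod>j<?n. ?g i j"] by (simp add: o_def)
  finally show ?thesis
    using len by (simp add: kron_sum_list_eq_sum_prod)
qed

lemma permute_list_replicate:
  "f permutes {..<n} \<Longrightarrow> permute_list f (replicate n x) = replicate n x"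
  by (rule replicate_eqI) simp_all

lemma listset_replicate: "listset (replicate n S) = {xs. length xs = n \<and> set xs \<subseteq> S}"
  by (induction n) (auto simp: set_Cons_def length_Suc_conv)

text \<open>\<open>perm_acts\<close> compares only the first \<open>n\<close> entries; the length
  assumption makes this equality of lists.\<close>

lemma perm_equiv_iff_permute_list:
  assumes "\<And>A. A \<in> X \<Longrightarrow> length A = n"
  shows "(A, B) \<in> perm_equiv n X \<longleftrightarrow>
    A \<in> X \<and> B \<in> X \<and> (\<exists>f. f permutes {..<n} \<and> A = permute_list f B)"
  using assms
  by (auto simp: perm_equiv_def perm_acts_def list_eq_iff_nth_eq permute_list_nth)

theorem theorem2:
  fixes S :: "'s set" and d0 d1 :: "'s mat" and n :: nat
    and M_lvl :: "'s list arrival_process" and \<rho> :: "'s list set set"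
  assumes "n \<ge> 1"
    and "is_MAP \<lparr>states = S, hidden = d0, active = d1\<rparr>"
    and "M_lvl = level_superposition (replicate n \<lparr>states = S, hidden = d0, active = d1\<rparr>)"
    and "\<rho> = perm_classes n (states M_lvl)"
  shows "lumpable M_lvl \<rho>"
proof -
  let ?X = "{xs. length xs = n \<and> set xs \<subseteq> S}"
  let ?Q = "total_matrix M_lvl"
  define Ms where
    "Ms = replicate n (total_matrix \<lparr>states = S, hidden = d0, active = d1\<rparr>)"
  have X: "states M_lvl = ?X"
    by (simp add: assms(3) level_superposition_def listset_replicate)
  \<comment> \<open>Kronecker sums are additive, so hidden and active rates can be merged within
    each sub-tree first.\<close>
  have Q: "?Q = kron_sum_list Ms"
    by (simp add: assms(3) total_matrix_level_superposition Ms_def)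
  have equiv: "equiv ?X (perm_equiv n ?X)"
    by (rule equiv_perm_equiv)
  have perm_equiv_iff: "(A, B) \<in> perm_equiv n ?X \<longleftrightarrow>
      A \<in> ?X \<and> B \<in> ?X \<and> (\<exists>f. f permutes {..<n} \<and> A = permute_list f B)" for A B
    by (rule perm_equiv_iff_permute_list) simp
  have "(\<Sum>B\<in>R'. ?Q A B) = (\<Sum>B\<in>R'. ?Q A' B)"
    if R: "R \<in> ?X // perm_equiv n ?X" "R' \<in> ?X // perm_equiv n ?X" "A \<in> R" "A' \<in> R"
    for R R' A A'
  proof -
    have "(A, A') \<in> perm_equiv n ?X"
      using quotient_eq_iff[OF equiv R(1,1,3,4)] by simp
    then obtain f where f: "f permutes {..<n}" and A: "A = permute_list f A'"
      and A': "length A' = n"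
      using perm_equiv_iff by blast
    have R'X: "B \<in> ?X" if "B \<in> R'" for B
      using in_quotient_imp_subset[OF equiv R(2)] that by blast
    have closed: "permute_list g B \<in> R'" if g: "g permutes {..<n}" and B: "B \<in> R'" for g B
    proof -
      have "permute_list g B \<in> ?X"
        using R'X[OF B] g by auto
      then have "(permute_list g B, B) \<in> perm_equiv n ?X"
        using R'X[OF B] g perm_equiv_iff by blast
      then have "(B, permute_list g B) \<in> perm_equiv n ?X"
        using equiv by (auto simp: equiv_def dest: symD)
      then show ?thesis
        by (rule in_quotient_imp_closed[OF equiv R(2) B])
    qed
    note finv = permutes_inv[OF f]
    \<comment> \<open>Together with \<open>closed\<close> for \<open>f\<close> and
      \<open>inv f\<close>, this makes \<open>permute_list f\<close> a bijection of
      \<open>R'\<close>.\<close>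
    have "permute_list f (permute_list (inv f) B) = B"
      "permute_list (inv f) (permute_list f B) = B" if "B \<in> R'" for B
      using R'X[OF that] f finv
      by (simp_all add: permute_list_compose[symmetric] permutes_inv_o)
    then have "(\<Sum>B\<in>R'. ?Q A B) = (\<Sum>B\<in>R'. ?Q A (permute_list f B))"
      using closed[OF f] closed[OF finv]
      by (intro sum.reindex_bij_witness[where i = "permute_list f" and j = "permute_list (inv f)"])
        auto
    also have "\<dots> = (\<Sum>B\<in>R'. ?Q A' B)"
    proof (intro sum.cong refl)
      fix B assume "B \<in> R'"
      \<comment> \<open>Since \<open>A\<close> is \<open>permute_list f A'\<close>, both arguments
        are permuted by \<open>f\<close>, which fixes the constant list \<open>Ms\<close>.\<close>
      then show "?Q A (permute_list f B) = ?Q A' B"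
        using kron_sum_list_permute_list[of f Ms A' B] f A' R'X
        by (simp add: Q A Ms_def permute_list_replicate)
    qed
    finally show ?thesis .
  qed
  then show ?thesis
    unfolding lumpable_def assms(4) perm_classes_def X by blast
qed

end
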